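(* For every positive integer $\mu$ there exists a strongly chordal graph $G$ such that no set of at most $\mu$ spanning trees of $G$ collectively $+2$-spans $G$.
   Context: All graphs are connected, finite, undirected, loopless and without multiple edges; $\mathrm{dist}_G(u,v)$ is the number of edges of a shortest path between $u$ and $v$ in $G$. For $c\ge 0$, a set $\mathcal{T}$ of spanning trees of a graph $G$ collectively $+c$-spans $G$ if for any two vertices $u,v$ of $G$ there is a tree $T\in\mathcal{T}$ with $\mathrm{dist}_T(u,v)\le \mathrm{dist}_G(u,v)+c$. A graph is chordal if it does not contain any induced cycle of length greater than 3. A graph $G$ is strongly chordal if it is chordal and every cycle of even length at least 6 in $G$ has an odd chord, i.e., an edge of $G$ connecting two vertices that are an odd distance greater than 1 apart from each other in the cycle. *)

theory Defs
  imports "Graph_Theory.Graph_Theory"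
begin

text \<open>
  A simple graph is a \<^term>\<open>pair_graph\<close>: a finite loopless digraph whose arc relation
  is symmetric, each undirected edge being the two opposite arcs. Graphs are connected
  throughout.
\<close>

definition simple_connected_graph :: "'a pair_pre_digraph \<Rightarrow> bool" where
  "simple_connected_graph G \<longleftrightarrow> pair_graph G \<and> connected (with_proj G)"

text \<open>
  A directed cycle of a symmetric digraph may have length two (an edge traversed back and
  forth); the cycles of the undirected graph are those of length at least three. The vertices
  of a cycle \<open>p\<close>, in cyclic order, are \<open>map fst p\<close>.
\<close>

definition ucycle :: "'a pair_pre_digraph \<Rightarrow> ('a \<times> 'a) list \<Rightarrow> bool" where
  "ucycle G p \<longleftrightarrow> pre_digraph.cycle (with_proj G) p \<and> 3 \<le> length p"

definition induced_cycle :: "'a pair_pre_digraph \<Rightarrow> ('a \<times> 'a) list \<Rightarrow> bool" where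
  "induced_cycle G p \<longleftrightarrow> ucycle G p \<and>
     arcs (with_proj G \<restriction> set (map fst p)) = set p \<union> (set p)\<inverse>"

definition chordal :: "'a pair_pre_digraph \<Rightarrow> bool" where
  "chordal G \<longleftrightarrow> simple_connected_graph G \<and> \<not> (\<exists>p. induced_cycle G p \<and> 3 < length p)"

text \<open>Distance along a cycle of length \<open>n\<close> between its vertices at positions \<open>i\<close> and \<open>j\<close>.\<close>

definition cycle_dist :: "nat \<Rightarrow> nat \<Rightarrow> nat \<Rightarrow> nat" where
  "cycle_dist n i j = (let d = max i j - min i j in min d (n - d))"

definition has_odd_chord :: "'a pair_pre_digraph \<Rightarrow> ('a \<times> 'a) list \<Rightarrow> bool" where
  "has_odd_chord G p \<longleftrightarrow>
     (\<exists>i<length p. \<exists>j<length p. (fst (p ! i), fst (p ! j)) \<in> parcs G \<and>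
        odd (cycle_dist (length p) i j) \<and> 1 < cycle_dist (length p) i j)"

definition strongly_chordal :: "'a pair_pre_digraph \<Rightarrow> bool" where
  "strongly_chordal G \<longleftrightarrow> chordal G \<and>
     (\<forall>p. ucycle G p \<and> even (length p) \<and> 6 \<le> length p \<longrightarrow> has_odd_chord G p)"

text \<open>
  The library constant \<^const>\<open>spanning_tree\<close> is not usable here: it forbids directed cycles
  only, so it admits no symmetric digraph with an edge but does admit orientations of graphs
  containing cycles.
\<close>

definition uspanning_tree :: "'a pair_pre_digraph \<Rightarrow> 'a pair_pre_digraph \<Rightarrow> bool" where
  "uspanning_tree T G \<longleftrightarrow> simple_connected_graph T \<and> \<not> (\<exists>p. ucycle T p) \<and>
     spanning (with_proj T) (with_proj G)"

definition gdist :: "'a pair_pre_digraph \<Rightarrow> 'a \<Rightarrow> 'a \<Rightarrow> ereal" where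
  "gdist G u v = wf_digraph.\<mu> (with_proj G) (\<lambda>_. 1) u v"

definition collectively_spans ::
    "real \<Rightarrow> 'a pair_pre_digraph set \<Rightarrow> 'a pair_pre_digraph \<Rightarrow> bool" where
  "collectively_spans c \<T> G \<longleftrightarrow>
     (\<forall>T\<in>\<T>. uspanning_tree T G) \<and>
     (\<forall>u\<in>pverts G. \<forall>v\<in>pverts G. \<exists>T\<in>\<T>. gdist T u v \<le> gdist G u v + ereal c)"

end

theory Submission
  imports Defs "HOL-Library.Sublist" "HOL-Library.Countable"
begin

text \<open>
  The graph is glued from copies of one gadget along cut vertices. The gadget has a root
  \<open>c\<close>, a clique of vertices \<open>Y l\<close> and \<open>U l\<close>, one pair for each sequence \<open>l\<close> of length \<open>m\<close> over
  \<open>D\<close> symbols, and a vertex \<open>V s\<close> for each shorter sequence \<open>s\<close>, adjacent to the \<open>Y l\<close> and \<open>U l\<close> with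
  \<open>s\<close> a prefix of \<open>l\<close>; the root is adjacent to the \<open>Y l\<close> only. Below every \<open>U l\<close> and \<open>V s\<close> hangs
  another copy, down to depth \<open>\<mu> + 1\<close>. The neighbourhoods of the \<open>V s\<close> in the clique form a
  laminar family, and this gives a strong elimination ordering.

  Given \<open>\<mu>\<close> spanning trees, choose \<open>l\<close> symbol by symbol so that \<open>l\<close> leaves the branch of the first
  two ancestors (towards \<open>c\<close>) of each \<open>V (take j l)\<close> in each tree. Then each tree brings at most
  three of these vertices within distance 2 of \<open>U l\<close>, so for some \<open>j\<close> the adjacent vertices \<open>u = U l\<close>
  and \<open>v = V (take j l)\<close> are at distance at least 3 in every tree. A tree that realises the
  distance 2 from \<open>c\<close> to both even has them at distance 4, by parity.

  Call a tree stretched at \<open>(c, s)\<close> if it does not realise the distance from \<open>c\<close> to \<open>s\<close>. If all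
  pairs are served with surplus 2, then, by induction on the height, below a root of height \<open>k\<close>
  there is an \<open>s\<close> with at least \<open>k\<close> trees stretched at \<open>(c, s)\<close>, which is absurd for
  \<open>k = \<mu> + 1\<close>. For the step, take such points \<open>s\<^sub>u\<close>, \<open>s\<^sub>v\<close> below \<open>u\<close> and \<open>v\<close>. If
  neither gains a stretched tree by moving the root up to \<open>c\<close>, then every tree is stretched at
  \<open>(u, s\<^sub>u)\<close> or \<open>(v, s\<^sub>v)\<close>, or realises the distances from \<open>c\<close> to \<open>u\<close> and \<open>v\<close>; either way it has
  surplus at least 3 on the pair \<open>(s\<^sub>u, s\<^sub>v)\<close>.
\<close>

section \<open>Distances and trees as relations\<close>

text \<open>Meaningful only for \<open>(x, y) \<in> R\<^sup>*\<close>; otherwise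
  \<open>LEAST\<close> is unspecified, hence the reachability hypotheses below.\<close>

definition rdist :: "('a \<times> 'a) set \<Rightarrow> 'a \<Rightarrow> 'a \<Rightarrow> nat" where
  "rdist R x y = (LEAST n. (x, y) \<in> R ^^ n)"

lemma rdist_le: "(x, y) \<in> R ^^ n \<Longrightarrow> rdist R x y \<le> n"
  unfolding rdist_def by (rule Least_le)

lemma relpow_rdist:
  assumes "(x, y) \<in> R\<^sup>*" shows "(x, y) \<in> R ^^ rdist R x y"
proof -
  from assms obtain n where "(x, y) \<in> R ^^ n" by (auto simp: rtrancl_power)
  then show ?thesis unfolding rdist_def by (rule LeastI)
qed

lemma rdist_triangle:
  assumes "(x, y) \<in> R\<^sup>*" "(y, z) \<in> R\<^sup>*"
  shows "rdist R x z \<le> rdist R x y + rdist R y z"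
proof -
  have "(x, z) \<in> R ^^ (rdist R x y + rdist R y z)"
    unfolding relpow_add using relpow_rdist[OF assms(1)] relpow_rdist[OF assms(2)] by blast
  then show ?thesis by (rule rdist_le)
qed

lemma relpow_mono:
  fixes R S :: "('a \<times> 'a) set"
  assumes "R \<subseteq> S" shows "R ^^ n \<subseteq> S ^^ n"
proof (induction n)
  case (Suc n)
  then show ?case using relcomp_mono[OF Suc.IH assms] by simp
qed simp

lemma rdist_antimono:
  assumes "R \<subseteq> S" "(x, y) \<in> R\<^sup>*"
  shows "rdist S x y \<le> rdist R x y"
  by (meson assms rdist_le relpow_mono relpow_rdist subsetD)

lemma relpow_sym:
  assumes "sym R" "(x, y) \<in> R ^^ n" shows "(y, x) \<in> R ^^ n"
  using assms(2)
proof (induction n arbitrary: y)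
  case (Suc n)
  then obtain z where "(x, z) \<in> R ^^ n" "(z, y) \<in> R" by auto
  then show ?case using Suc.IH assms(1) by (meson relpow_Suc_I2 symD)
qed auto

lemma rdist_sym:
  assumes "sym R" shows "rdist R x y = rdist R y x"
proof -
  have "(x, y) \<in> R ^^ n \<longleftrightarrow> (y, x) \<in> R ^^ n" for n
    using relpow_sym[OF assms] by blast
  then show ?thesis by (simp add: rdist_def)
qed

section \<open>Distances through a cut vertex\<close>

text \<open>A walk can leave \<open>S\<close> only from \<open>z\<close>, so it splits at its first
  visit to \<open>z\<close>.\<close>

lemma relpow_through_cut:
  assumes "(x, y) \<in> R ^^ n" "x \<in> S" "y \<notin> S \<or> y = z"
    and cut: "\<And>a b. (a, b) \<in> R \<Longrightarrow> a \<in> S \<Longrightarrow> a \<noteq> z \<Longrightarrow> b \<in> S"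
  shows "\<exists>i j. i + j = n \<and> (x, z) \<in> R ^^ i \<and> (z, y) \<in> R ^^ j"
  using assms(1,2)
proof (induction n arbitrary: x)
  case 0
  then have "x = z" "y = z" using assms(3) by auto
  then show ?case by (auto intro!: exI[of _ 0])
next
  case (Suc n)
  show ?case
  proof (cases "x = z")
    case True
    then show ?thesis using Suc.prems by (intro exI[of _ 0] exI[of _ "Suc n"]) simp
  next
    case False
    obtain x' where x': "(x, x') \<in> R" "(x', y) \<in> R ^^ n"
      using Suc.prems(1) by (meson relpow_Suc_D2)
    with cut False Suc.prems(2) have "x' \<in> S" by blast
    from Suc.IH[OF x'(2) this] obtain i j
      where "i + j = n" "(x', z) \<in> R ^^ i" "(z, y) \<in> R ^^ j" by blast
    moreover have "(x, z) \<in> R ^^ Suc i"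
      using x'(1) calculation(2) by (rule relpow_Suc_I2)
    ultimately show ?thesis by (metis add_Suc)
  qed
qed

lemma rdist_through_cut:
  assumes "(x, y) \<in> R\<^sup>*" "(x, z) \<in> R\<^sup>*" "(z, y) \<in> R\<^sup>*" "x \<in> S" "y \<notin> S \<or> y = z"
    and "\<And>a b. (a, b) \<in> R \<Longrightarrow> a \<in> S \<Longrightarrow> a \<noteq> z \<Longrightarrow> b \<in> S"
  shows "rdist R x y = rdist R x z + rdist R z y"
proof -
  obtain i j where "i + j = rdist R x y" "(x, z) \<in> R ^^ i" "(z, y) \<in> R ^^ j"
    using relpow_through_cut[where S = S and z = z, OF relpow_rdist[OF assms(1)] assms(4,5)]
      assms(6) by blast
  then have "rdist R x z + rdist R z y \<le> rdist R x y"
    using rdist_le by (metis add_mono)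
  then show ?thesis using rdist_triangle[OF assms(2,3)] by simp
qed

section \<open>Forests and their parent structure\<close>

text \<open>Symmetric forests, phrased through reachability instead of cycles. Loops are excluded
  because the closure is reflexive.\<close>

definition bridges_only :: "('a \<times> 'a) set \<Rightarrow> bool" where
  "bridges_only R \<longleftrightarrow> sym R \<and> (\<forall>x y. (x, y) \<in> R \<longrightarrow> (x, y) \<notin> (R - {(x, y), (y, x)})\<^sup>*)"

definition parent :: "('a \<times> 'a) set \<Rightarrow> 'a \<Rightarrow> ('a \<times> 'a) set" where
  "parent R c = {(x, p). (c, x) \<in> R\<^sup>* \<and> (x, p) \<in> R \<and> rdist R c x = Suc (rdist R c p)}"

text \<open>Made for detours: it contains shortest walks from \<open>c\<close> to depth
  \<open>n\<close>, but neither edges within a level nor edges reaching deeper.\<close>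

definition level_steps :: "('a \<times> 'a) set \<Rightarrow> 'a \<Rightarrow> nat \<Rightarrow> ('a \<times> 'a) set" where
  "level_steps R c n =
     {(a, b) \<in> R. rdist R c a \<noteq> rdist R c b \<and> rdist R c a \<le> n \<and> rdist R c b \<le> n}"

lemma sym_level_steps: "sym R \<Longrightarrow> sym (level_steps R c n)"
  unfolding level_steps_def sym_def by auto

lemma rtrancl_level_steps:
  assumes "(c, x) \<in> R\<^sup>*" shows "(c, x) \<in> (level_steps R c (rdist R c x))\<^sup>*"
  using assms
proof (induction "rdist R c x" arbitrary: x)
  case 0
  then have "(c, x) \<in> R ^^ 0" using relpow_rdist by metis
  then show ?case by simp
next
  case (Suc n)
  have "(c, x) \<in> R ^^ Suc n" using relpow_rdist Suc by metis
  then obtain z where z: "(c, z) \<in> R ^^ n" "(z, x) \<in> R" by auto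
  then have cz: "(c, z) \<in> R\<^sup>*" by (meson relpow_imp_rtrancl)
  have "rdist R c x \<le> Suc (rdist R c z)"
    using relpow_rdist[OF cz] z(2) by (metis rdist_le relpow_Suc_I)
  with rdist_le[OF z(1)] Suc(2) have n: "n = rdist R c z" by simp
  have "(c, z) \<in> (level_steps R c n)\<^sup>*"
    using Suc(1)[OF n cz] n by simp
  moreover have "level_steps R c n \<subseteq> level_steps R c (rdist R c x)"
    using Suc(2) by (auto simp: level_steps_def)
  ultimately have "(c, z) \<in> (level_steps R c (rdist R c x))\<^sup>*"
    by (meson rtrancl_mono subsetD)
  moreover have "(z, x) \<in> level_steps R c (rdist R c x)"
    using z(2) n Suc(2) by (auto simp: level_steps_def)
  ultimately show ?case by simp
qed

lemma rtrancl_level_steps2: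
  assumes "sym R" "(c, x) \<in> R\<^sup>*" "(c, y) \<in> R\<^sup>*" "rdist R c x = n" "rdist R c y = n"
  shows "(x, y) \<in> (level_steps R c n)\<^sup>*"
  by (metis assms rtrancl_level_steps sym_level_steps sym_rtrancl symD rtrancl_trans)

lemma rdist_edge_le:
  assumes "(c, x) \<in> R\<^sup>*" "(x, y) \<in> R"
  shows "rdist R c y \<le> Suc (rdist R c x)"
  by (metis assms rdist_le relpow_Suc_I relpow_rdist)

text \<open>An edge within a level would be bypassed by shortest walks from its ends to
  \<open>c\<close>, so it would not be a bridge.\<close>

lemma bridges_only_edge:
  assumes "bridges_only R" "(c, x) \<in> R\<^sup>*" "(x, y) \<in> R"
  shows "(x, y) \<in> parent R c \<or> (y, x) \<in> parent R c"
proof -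
  have R: "sym R" "(x, y) \<notin> (R - {(x, y), (y, x)})\<^sup>*"
    using assms unfolding bridges_only_def by auto
  have yx: "(y, x) \<in> R" and cy: "(c, y) \<in> R\<^sup>*"
    using R(1) assms by (auto dest: symD)
  have "rdist R c x \<noteq> rdist R c y"
  proof
    assume eq: "rdist R c x = rdist R c y"
    have "(x, y) \<in> (level_steps R c (rdist R c y))\<^sup>*"
      using rtrancl_level_steps2[OF R(1) assms(2) cy] eq by simp
    moreover have "level_steps R c (rdist R c y) \<subseteq> R - {(x, y), (y, x)}"
      using eq by (auto simp: level_steps_def)
    ultimately show False using R(2) by (meson rtrancl_mono subsetD)
  qed
  with rdist_edge_le[OF assms(2,3)] rdist_edge_le[OF cy yx] show ?thesis
    using assms(2,3) yx cy unfolding parent_def by auto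
qed

text \<open>Two parents would be joined through \<open>c\<close> without meeting \<open>x\<close>,
  which is one level deeper; followed by the edge from \<open>q\<close> to \<open>x\<close>, this
  bypasses the edge from \<open>p\<close> to \<open>x\<close>.\<close>

lemma parent_unique:
  assumes "bridges_only R" "(x, p) \<in> parent R c" "(x, q) \<in> parent R c"
  shows "p = q"
proof (rule ccontr)
  assume "p \<noteq> q"
  have R: "sym R" "(x, p) \<in> R" "(x, q) \<in> R" "(c, x) \<in> R\<^sup>*"
    "rdist R c x = Suc (rdist R c p)" "rdist R c x = Suc (rdist R c q)"
    using assms unfolding bridges_only_def parent_def by auto
  have px: "(p, x) \<in> R" "(q, x) \<in> R" using R by (auto dest: symD)
  have "(c, p) \<in> R\<^sup>*" "(c, q) \<in> R\<^sup>*" using R by (meson rtrancl.rtrancl_into_rtrancl)+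
  then have "(p, q) \<in> (level_steps R c (rdist R c p))\<^sup>*"
    using rtrancl_level_steps2[OF R(1)] R by simp
  moreover have "level_steps R c (rdist R c p) \<subseteq> R - {(p, x), (x, p)}"
    using R by (auto simp: level_steps_def)
  ultimately have "(p, q) \<in> (R - {(p, x), (x, p)})\<^sup>*" by (meson rtrancl_mono subsetD)
  moreover have "(q, x) \<in> R - {(p, x), (x, p)}" using px(2) \<open>p \<noteq> q\<close> R(5) by force
  ultimately have "(p, x) \<in> (R - {(p, x), (x, p)})\<^sup>*"
    by (rule rtrancl_into_rtrancl)
  then show False using assms(1) px unfolding bridges_only_def by blast
qed

text \<open>Every step changes the distance to \<open>c\<close> by exactly one: forests are
  bipartite.\<close>

lemma bridges_only_parity:
  assumes "bridges_only R" "(c, x) \<in> R\<^sup>*" "(x, y) \<in> R ^^ n"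
  shows "even (n + rdist R c x + rdist R c y)"
  using assms(3)
proof (induction n arbitrary: y)
  case 0
  then show ?case by simp
next
  case (Suc n)
  then obtain z where z: "(x, z) \<in> R ^^ n" "(z, y) \<in> R" by auto
  have "(c, z) \<in> R\<^sup>*" using assms(2) z(1) by (meson relpow_imp_rtrancl rtrancl_trans)
  from bridges_only_edge[OF assms(1) this z(2)] Suc.IH[OF z(1)]
  show ?case unfolding parent_def by auto
qed

text \<open>Two steps go up twice, down twice, or up and then down. Down and then up would return to
  \<open>x\<close>, since parents are unique.\<close>

lemma rdist_le_2_cases:
  assumes "bridges_only R" "(c, x) \<in> R\<^sup>*" "(x, y) \<in> R\<^sup>*" "rdist R x y \<le> 2" "x \<noteq> y"
  shows "(x, y) \<in> parent R c \<union> parent R c O parent R c \<or>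
         (y, x) \<in> parent R c \<union> parent R c O parent R c \<or>
         (\<exists>z. (x, z) \<in> parent R c \<and> (y, z) \<in> parent R c)"
proof -
  let ?P = "parent R c"
  have w: "(x, y) \<in> R ^^ rdist R x y" using relpow_rdist[OF assms(3)] .
  then have "rdist R x y \<noteq> 0" using assms(5) by (intro notI) simp
  then consider "rdist R x y = 1" | "rdist R x y = 2" using assms(4) by linarith
  then show ?thesis
  proof cases
    case 1
    then have "(x, y) \<in> R" using w by simp
    then show ?thesis using bridges_only_edge[OF assms(1,2)] by blast
  next
    case 2
    then obtain z where z: "(x, z) \<in> R" "(z, y) \<in> R" using w by (auto simp: numeral_2_eq_2)
    have "(c, z) \<in> R\<^sup>*" using assms(2) z(1) by simp
    then have "(x, z) \<in> ?P \<or> (z, x) \<in> ?P" "(z, y) \<in> ?P \<or> (y, z) \<in> ?P"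
      using bridges_only_edge[OF assms(1)] assms(2) z by blast+
    then show ?thesis using parent_unique[OF assms(1)] assms(5) by blast
  qed
qed

section \<open>The gadgets and their gluing\<close>

text \<open>
  A vertex is a word, with the innermost letter at its head: \<open>x # w\<close> is the vertex \<open>x\<close> of the
  gadget with root \<open>w\<close>.
\<close>

datatype letter = Y "nat list" | U "nat list" | V "nat list"

instance letter :: countable by countable_datatype

fun ladj :: "letter \<Rightarrow> letter \<Rightarrow> bool" where
  "ladj (V s) (V t) = False"
| "ladj (V s) (Y l) = prefix s l"
| "ladj (V s) (U l) = prefix s l"
| "ladj (Y l) (V s) = prefix s l"
| "ladj (U l) (V s) = prefix s l"
| "ladj x y = (x \<noteq> y)"

fun label :: "letter \<Rightarrow> nat list" where
  "label (Y l) = l" | "label (U l) = l" | "label (V l) = l"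

fun is_Y :: "letter \<Rightarrow> bool" where
  "is_Y (Y l) = True" | "is_Y _ = False"

definition letters :: "nat \<Rightarrow> nat \<Rightarrow> letter set" where
  "letters D m = {x. set (label x) \<subseteq> {..<D} \<and>
     (case x of V s \<Rightarrow> length s < m | _ \<Rightarrow> length (label x) = m)}"

text \<open>The words below which a gadget may hang; none hangs below a \<open>Y\<close>. In
  \<open>words\<close> this restricts the tail, the head being the last letter added.\<close>

definition inner :: "letter list \<Rightarrow> bool" where
  "inner w \<longleftrightarrow> w = [] \<or> \<not> is_Y (hd w)"

definition words :: "nat \<Rightarrow> nat \<Rightarrow> nat \<Rightarrow> letter list set" where
  "words K D m = {w. length w \<le> K \<and> set w \<subseteq> letters D m \<and> (\<forall>x\<in>set (tl w). \<not> is_Y x)}"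

definition wadj :: "letter list \<Rightarrow> letter list \<Rightarrow> bool" where
  "wadj a b \<longleftrightarrow> (\<exists>x y w. a = x # w \<and> b = y # w \<and> ladj x y) \<or> (\<exists>l. a = Y l # b) \<or> (\<exists>l. b = Y l # a)"

definition wedges :: "nat \<Rightarrow> nat \<Rightarrow> nat \<Rightarrow> (letter list \<times> letter list) set" where
  "wedges K D m = {(a, b). a \<in> words K D m \<and> b \<in> words K D m \<and> wadj a b}"

lemma ladj_sym: "ladj x y \<Longrightarrow> ladj y x"
  by (cases x; cases y) auto

lemma ladj_irrefl: "\<not> ladj x x"
  by (cases x) auto

lemma wadj_sym: "wadj a b \<Longrightarrow> wadj b a"
  unfolding wadj_def using ladj_sym by blast

lemma wadj_irrefl: "\<not> wadj a a"
  unfolding wadj_def using ladj_irrefl by auto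

lemma sym_wedges: "sym (wedges K D m)"
  unfolding wedges_def sym_def using wadj_sym by auto

lemma finite_letters: "finite (letters D m)"
proof -
  let ?L = "{l. set l \<subseteq> {..<D} \<and> length l \<le> m}"
  have "letters D m \<subseteq> Y ` ?L \<union> U ` ?L \<union> V ` ?L"
  proof
    fix x assume "x \<in> letters D m"
    then show "x \<in> Y ` ?L \<union> U ` ?L \<union> V ` ?L"
      by (cases x) (auto simp: letters_def)
  qed
  moreover have "finite ?L" by (rule finite_lists_length_le) simp
  ultimately show ?thesis by (meson finite_UnI finite_imageI finite_subset)
qed

lemma finite_words: "finite (words K D m)"
proof -
  have "words K D m \<subseteq> {w. set w \<subseteq> letters D m \<and> length w \<le> K}"
    by (auto simp: words_def)
  moreover have "finite \<dots>" by (rule finite_lists_length_le[OF finite_letters])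
  ultimately show ?thesis by (rule finite_subset)
qed

lemma Nil_in_words: "[] \<in> words K D m"
  by (simp add: words_def)

lemma Cons_in_words_iff:
  "x # w \<in> words K D m \<longleftrightarrow> w \<in> words K D m \<and> inner w \<and> x \<in> letters D m \<and> length w < K"
  by (cases w) (auto simp: words_def inner_def)

lemma in_letters_simps [simp]:
  "Y l \<in> letters D m \<longleftrightarrow> set l \<subseteq> {..<D} \<and> length l = m"
  "U l \<in> letters D m \<longleftrightarrow> set l \<subseteq> {..<D} \<and> length l = m"
  "V l \<in> letters D m \<longleftrightarrow> set l \<subseteq> {..<D} \<and> length l < m"
  by (auto simp: letters_def)

section \<open>The elimination ranking\<close>

text \<open>\<open>V\<close> letters go first, longer labels earlier; \<open>Y\<close> goes last
  because it also sees the root.\<close>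

fun lrank :: "nat \<Rightarrow> letter \<Rightarrow> nat" where
  "lrank m (V s) = m - Suc (length s)" | "lrank m (U l) = m" | "lrank m (Y l) = Suc m"

text \<open>Deeper words go first: the factor \<open>m + 2\<close> exceeds every value of
  \<open>lrank\<close>.\<close>

definition wrank :: "nat \<Rightarrow> nat \<Rightarrow> letter list \<Rightarrow> nat" where
  "wrank K m w = (K - length w) * (m + 2) + (case w of [] \<Rightarrow> 0 | x # _ \<Rightarrow> lrank m x)"

lemma wrank_Cons: "wrank K m (x # w) = (K - Suc (length w)) * (m + 2) + lrank m x"
  by (simp add: wrank_def)

lemma lrank_less: "lrank m x < m + 2"
  by (cases x) auto

lemma wrank_less:
  assumes "length b < length a" "length a \<le> K"
  shows "wrank K m a < wrank K m b"
proof -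
  obtain x w where a: "a = x # w" using assms by (cases a) auto
  have "wrank K m a < Suc (K - length a) * (m + 2)"
    using a lrank_less[of m x] by (simp add: wrank_Cons)
  also have "\<dots> \<le> (K - length b) * (m + 2)"
    by (rule mult_le_mono1) (use assms in auto)
  also have "\<dots> \<le> wrank K m b" by (simp add: wrank_def)
  finally show ?thesis .
qed

lemma wrank_leD:
  assumes "wrank K m a \<le> wrank K m b" "length b \<le> K"
  shows "length b \<le> length a"
  using wrank_less[of a b K m] assms by linarith

text \<open>
  The closed neighbourhood matrix, ordered by rank, is \<open>\<Gamma>\<close>-free (Farber). Ties in the rank are
  harmless, so no linear order has to be fixed.
\<close>

lemma letter_strong_elimination:
  assumes "{a, b, p, q} \<subseteq> letters D m" "lrank m a \<le> lrank m b" "lrank m p \<le> lrank m q"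
    and "a = p \<or> ladj a p" "a = q \<or> ladj a q" "b = p \<or> ladj b p"
  shows "b = q \<or> ladj b q"
  using assms
  \<comment> \<open>The substantial cases have two \<open>V\<close> letters with a common neighbour:
    their labels are prefixes of one sequence, hence comparable, and the larger rank belongs to the
    shorter label.\<close>
  by (cases a; cases b; cases p; cases q)
    (auto dest: prefix_same_cases prefix_length_prefix intro: prefix_order.trans)


lemma Y_lrank_le: "Suc m \<le> lrank m x \<Longrightarrow> \<exists>l. x = Y l"
  by (cases x) auto

lemma wadj_cases [consumes 1, case_names eq sibling up down]:
  assumes "a = b \<or> wadj a b"
  obtains "a = b" | x y w where "a = x # w" "b = y # w" "ladj x y"
    | l where "a = Y l # b" | l where "b = Y l # a"
  using assms unfolding wadj_def by blast

lemma wadj_siblings: "wadj (x # w) (y # w) \<longleftrightarrow> ladj x y"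
  by (auto simp: wadj_def)

text \<open>As \<open>b\<close> is no deeper than \<open>a\<close> and \<open>q\<close> no deeper
  than \<open>p\<close>, the question stays within one gadget and its root. The root sees only the
  \<open>Y\<close> letters of its gadget, and these have top rank.\<close>

lemma word_strong_elimination:
  assumes W: "{a, b, p, q} \<subseteq> words K D m"
    and ab: "wrank K m a \<le> wrank K m b" and pq: "wrank K m p \<le> wrank K m q"
    and ap: "a = p \<or> wadj a p" and aq: "a = q \<or> wadj a q" and bp: "b = p \<or> wadj b p"
  shows "b = q \<or> wadj b q"
proof -
  have len: "length b \<le> length a" "length q \<le> length p"
    using wrank_leD[OF ab] wrank_leD[OF pq] W by (auto simp: words_def)
  have key: "b = q \<or> wadj b q" if "a = x # w" "p = y # w" "x = y \<or> ladj x y" for x y w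
  proof -
    have xy: "x \<in> letters D m" "y \<in> letters D m"
      using W that by (auto simp: Cons_in_words_iff)
    have b: "(\<exists>z. b = z # w \<and> z \<in> letters D m \<and> lrank m x \<le> lrank m z \<and> (z = y \<or> ladj z y)) \<or>
      b = w \<and> (\<exists>l. y = Y l)"
      using bp
    proof (cases rule: wadj_cases)
      case (sibling x' y' w')
      then show ?thesis using that ab W by (auto simp: wrank_Cons Cons_in_words_iff)
    qed (use that len ab W in \<open>auto simp: wrank_Cons Cons_in_words_iff\<close>)
    have q: "(\<exists>z. q = z # w \<and> z \<in> letters D m \<and> lrank m y \<le> lrank m z \<and> (x = z \<or> ladj x z)) \<or>
      q = w \<and> (\<exists>l. x = Y l)"
      using aq
    proof (cases rule: wadj_cases)
      case (sibling x' y' w')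
      then show ?thesis using that pq W by (auto simp: wrank_Cons Cons_in_words_iff)
    qed (use that len pq W in \<open>auto simp: wrank_Cons Cons_in_words_iff\<close>)
    from b q consider
      z z' where "b = z # w" "q = z' # w" "z \<in> letters D m" "z' \<in> letters D m"
        "lrank m x \<le> lrank m z" "lrank m y \<le> lrank m z'" "z = y \<or> ladj z y" "x = z' \<or> ladj x z'"
      | z l where "b = z # w" "q = w" "x = Y l" "lrank m x \<le> lrank m z"
      | z l where "q = z # w" "b = w" "y = Y l" "lrank m y \<le> lrank m z"
      | "b = w" "q = w"
      by blast
    then show ?thesis
    proof cases
      case 1
      then show ?thesis
        using letter_strong_elimination[of x z y z' D m] xy that(3) by (auto simp: wadj_siblings)
    next
      case 2
      then show ?thesis using Y_lrank_le[of m z] by (auto simp: wadj_def)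
    next
      case 3
      then show ?thesis using Y_lrank_le[of m z] by (auto simp: wadj_def)
    qed simp
  qed
  from ap show ?thesis
  proof (cases rule: wadj_cases)
    case eq
    show ?thesis
    proof (cases a)
      case Nil
      then have "b = []" "q = []" using len eq by auto
      then show ?thesis by simp
    next
      case (Cons x w)
      then show ?thesis using key[of x w x] eq by simp
    qed
  next
    case (sibling x y w)
    then show ?thesis using key by blast
  next
    case (up l)
    have "q = p" using aq
      by (cases rule: wadj_cases) (use up len in auto)
    then show ?thesis using bp by simp
  next
    case (down l)
    have "b = a" using bp
      by (cases rule: wadj_cases) (use down len in auto)
    then show ?thesis using aq by simp
  qed
qed

section \<open>Connectivity and cut vertices of the glued graph\<close>

lemma wedges_two_steps:
  assumes "0 < D" "x # w \<in> words K D m" "\<not> is_Y x"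
  shows "(w, x # w) \<in> wedges K D m ^^ 2"
proof -
  \<comment> \<open>Padding with \<open>0\<close> gives full length, so \<open>Y l # w\<close> is
    adjacent to both ends. For a \<open>U\<close> letter nothing is padded.\<close>
  define l where "l = label x @ replicate (m - length (label x)) 0"
  have x: "w \<in> words K D m" "inner w" "x \<in> letters D m" "length w < K"
    using assms(2) by (auto simp: Cons_in_words_iff)
  have "Y l \<in> letters D m" "ladj (Y l) x"
    using x(3) assms(1,3) by (cases x; auto simp: l_def)+
  with x have "(w, Y l # w) \<in> wedges K D m" "(Y l # w, x # w) \<in> wedges K D m"
    using assms(2) by (auto simp: wedges_def wadj_def Cons_in_words_iff)
  then show ?thesis by (auto simp: numeral_2_eq_2)
qed

lemma wedges_suffix_connected:
  assumes "0 < D" "s \<in> words K D m" "suffix w s"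
  shows "(w, s) \<in> (wedges K D m)\<^sup>*"
  using assms(2,3)
proof (induction s)
  case (Cons x s)
  show ?case
  proof (cases "w = x # s")
    case False
    then have "(w, s) \<in> (wedges K D m)\<^sup>*"
      using Cons by (auto simp: suffix_Cons Cons_in_words_iff)
    moreover have "(s, x # s) \<in> (wedges K D m)\<^sup>*"
    proof (cases "is_Y x")
      case True
      then have "(s, x # s) \<in> wedges K D m"
        using Cons.prems(1) by (cases x) (auto simp: wedges_def wadj_def Cons_in_words_iff)
      then show ?thesis by blast
    next
      case False
      then show ?thesis
        using wedges_two_steps[OF assms(1) Cons.prems(1)] relpow_imp_rtrancl by blast
    qed
    ultimately show ?thesis by (rule rtrancl_trans)
  qed simp
qed simp

lemma wedges_connected:
  assumes "0 < D" "s \<in> words K D m" "t \<in> words K D m"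
  shows "(s, t) \<in> (wedges K D m)\<^sup>*"
  using wedges_suffix_connected[OF assms(1)] assms(2,3) sym_wedges
  by (metis Nil_in_words Nil_suffix rtrancl_trans symD sym_rtrancl)

text \<open>Edges only exchange, add or remove the head letter. This makes \<open>z\<close> a cut
  vertex in the sense of \<open>rdist_through_cut\<close>.\<close>

lemma wedges_leave_subtree:
  assumes "(a, b) \<in> wedges K D m" "suffix z a" "a \<noteq> z"
  shows "suffix z b"
  using assms by (auto simp: wedges_def wadj_def suffix_Cons)

text \<open>Greedy choice: the symbols forbidden at position \<open>j\<close> depend only on the
  earlier symbols and are fewer than \<open>D\<close>.\<close>

lemma avoiding_list:
  assumes "\<And>s. finite (F s) \<and> card (F s) < D"
  shows "\<exists>l. length l = m \<and> set l \<subseteq> {..<D} \<and> (\<forall>j<m. l ! j \<notin> F (take j l))"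
proof (induction m)
  case (Suc m)
  then obtain l where l: "length l = m" "set l \<subseteq> {..<D}" "\<forall>j<m. l ! j \<notin> F (take j l)" by blast
  have "\<not> {..<D} \<subseteq> F l"
    using assms[of l] card_mono[of "F l" "{..<D}"] by auto
  then obtain d where "d < D" "d \<notin> F l" by auto
  with l show ?case
    by (intro exI[of _ "l @ [d]"]) (auto simp: nth_append less_Suc_eq)
qed simp

lemma card_le_1:
  assumes "\<And>x y. x \<in> S \<Longrightarrow> y \<in> S \<Longrightarrow> x = y"
  shows "finite S \<and> card S \<le> 1"
proof (cases "S = {}")
  case False
  then obtain x where "x \<in> S" by blast
  then have "S = {x}" using assms by blast
  then show ?thesis by simp
qed simp

section \<open>Few trees fail on a common pair\<close>

text \<open>\<open>D\<close> is large because each tree forbids at most two symbols per position,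
  \<open>m\<close> because each tree spoils at most three prefix lengths.\<close>

locale tree_family =
  fixes K D m \<mu> :: nat and I :: "'i set" and R :: "'i \<Rightarrow> (letter list \<times> letter list) set"
  assumes large: "3 * \<mu> < m" "2 * \<mu> < D"
    and few: "finite I" "card I \<le> \<mu>"
    and sub: "i \<in> I \<Longrightarrow> R i \<subseteq> wedges K D m"
    and tree: "i \<in> I \<Longrightarrow> bridges_only (R i)"
    and conn: "i \<in> I \<Longrightarrow> a \<in> words K D m \<Longrightarrow> b \<in> words K D m \<Longrightarrow> (a, b) \<in> (R i)\<^sup>*"
begin

lemma tree_sym: "i \<in> I \<Longrightarrow> sym (R i)"
  using tree by (auto simp: bridges_only_def)

text \<open>Once \<open>U l\<close> is no ancestor within two steps, distance at most 2 leaves three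
  configurations, each possible for at most one \<open>j\<close> per tree.\<close>

lemma branch_far_apart:
  assumes w: "w \<in> words K D m" "length w < K" "inner w"
  shows "\<exists>l j. length l = m \<and> set l \<subseteq> {..<D} \<and> j < m \<and>
    (\<forall>i\<in>I. 3 \<le> rdist (R i) (U l # w) (V (take j l) # w))"
proof -
  define P where "P i = parent (R i) w" for i
  define A where "A i x = (P i \<union> P i O P i) `` {x}" for i x
  \<comment> \<open>The symbols leading from \<open>s\<close> towards the first two ancestors. Where
    \<open>hd\<close> or \<open>!\<close> is unspecified, an arbitrary symbol is forbidden too,
    which the count allows.\<close>
  define F where "F s = (\<Union>i\<in>I. (\<lambda>x. label (hd x) ! length s) ` A i (V s # w))" for s
  have P_sub: "P i \<subseteq> wedges K D m" if "i \<in> I" for i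
    using sub[OF that] by (auto simp: P_def parent_def)
  have P_unique: "p = q" if "i \<in> I" "(x, p) \<in> P i" "(x, q) \<in> P i" for i x p q
    using parent_unique[OF tree[OF that(1)]] that unfolding P_def by blast
  have A: "finite (A i x) \<and> card (A i x) \<le> 2" if "i \<in> I" for i x
  proof -
    have "finite (P i `` {x}) \<and> card (P i `` {x}) \<le> 1"
      by (rule card_le_1) (use P_unique[OF that] in blast)
    moreover have "finite ((P i O P i) `` {x}) \<and> card ((P i O P i) `` {x}) \<le> 1"
      by (rule card_le_1) (use P_unique[OF that] in blast)
    moreover have "A i x = P i `` {x} \<union> (P i O P i) `` {x}" by (auto simp: A_def)
    ultimately show ?thesis
      using card_Un_le[of "P i `` {x}" "(P i O P i) `` {x}"] by simp
  qed
  have "finite (F s) \<and> card (F s) < D" for s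
  proof -
    have "card (F s) \<le> (\<Sum>i\<in>I. card ((\<lambda>x. label (hd x) ! length s) ` A i (V s # w)))"
      unfolding F_def by (rule card_UN_le[OF few(1)])
    also have "\<dots> \<le> (\<Sum>i\<in>I. 2)"
      by (intro sum_mono) (meson A card_image_le order_trans)
    also have "\<dots> < D" using few(2) large(2) by simp
    finally show ?thesis using A few(1) by (auto simp: F_def)
  qed
  from avoiding_list[of F D m, OF this] obtain l
    where l: "length l = m" "set l \<subseteq> {..<D}" "\<forall>j<m. l ! j \<notin> F (take j l)" by blast
  define u where "u = U l # w"
  define v where "v j = V (take j l) # w" for j
  have u: "u \<in> words K D m"
    using w l by (simp add: u_def Cons_in_words_iff)
  have v: "v j \<in> words K D m" if "j < m" for j
    using w l that set_take_subset[of j l] by (auto simp: v_def Cons_in_words_iff)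
  have v_inj: "j = j'" if "v j = v j'" "j < m" "j' < m" for j j'
    using that l(1) by (auto simp: v_def dest: arg_cong[where f = length])
  have avoid: "label (hd x) ! j \<noteq> l ! j" if "i \<in> I" "j < m" "x \<in> A i (v j)" for i j x
  proof
    assume "label (hd x) ! j = l ! j"
    then have "l ! j \<in> F (take j l)"
      using that l(1) by (auto simp: F_def v_def intro!: bexI[of _ i] image_eqI[of _ _ x])
    then show False using l(3) that(2) by blast
  qed
  define B where "B i = {j. j < m \<and> rdist (R i) u (v j) \<le> 2}" for i
  have "finite (B i) \<and> card (B i) \<le> 3" if i: "i \<in> I" for i
  proof -
    define B1 where "B1 = {j. j < m \<and> (u, v j) \<in> P i}"
    define B2 where "B2 = {j. j < m \<and> (u, v j) \<in> P i O P i}"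
    define B3 where "B3 = {j. j < m \<and> (\<exists>x. (u, x) \<in> P i \<and> (v j, x) \<in> P i)}"
    have sub: "B i \<subseteq> B1 \<union> B2 \<union> B3"
    proof
      fix j assume "j \<in> B i"
      then have j: "j < m" "rdist (R i) u (v j) \<le> 2" by (auto simp: B_def)
      \<comment> \<open>As one of the first two ancestors, \<open>u\<close> would have put
        \<open>l ! j\<close> among the forbidden symbols.\<close>
      have "(v j, u) \<notin> P i \<union> P i O P i"
        using avoid[OF i j(1), of u] by (auto simp: A_def u_def)
      moreover have "u \<noteq> v j" by (simp add: u_def v_def)
      ultimately show "j \<in> B1 \<union> B2 \<union> B3"
        using rdist_le_2_cases[OF tree[OF i] conn[OF i w(1) u] conn[OF i u v[OF j(1)]] j(2)] j(1)
        unfolding B1_def B2_def B3_def P_def by blast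
    qed
    have B1: "finite B1 \<and> card B1 \<le> 1"
      by (rule card_le_1) (use P_unique[OF i] v_inj in \<open>unfold B1_def, blast\<close>)
    have B2: "finite B2 \<and> card B2 \<le> 1"
      by (rule card_le_1) (use P_unique[OF i] v_inj in \<open>unfold B2_def, blast\<close>)
    have B3: "finite B3 \<and> card B3 \<le> 1"
    proof (rule card_le_1)
      have False if in_B3: "j \<in> B3" "j' \<in> B3" and less: "j < j'" for j j'
      proof -
        obtain x x' where "(u, x) \<in> P i" "(v j, x) \<in> P i" "(u, x') \<in> P i" "(v j', x') \<in> P i"
          using in_B3 unfolding B3_def by blast
        moreover from calculation have "x' = x" using P_unique[OF i] by blast
        ultimately have x: "(u, x) \<in> P i" "(v j, x) \<in> P i" "(v j', x) \<in> P i" "j' < m"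
          using in_B3(2) by (auto simp: B3_def)
        then have "wadj u x" "wadj (v j') x"
          using P_sub[OF i] by (auto simp: wedges_def)
        \<comment> \<open>A common neighbour of \<open>u\<close> and \<open>v j'\<close> is a clique
          vertex whose label extends \<open>take j' l\<close>, so it agrees with \<open>l\<close> at
          \<open>j < j'\<close>.\<close>
        then have "prefix (take j' l) (label (hd x))"
          by (auto simp: wadj_def u_def v_def elim!: ladj.elims)
        then have "label (hd x) ! j = l ! j"
          using less x(4) l(1) by (auto simp: prefix_def nth_append)
        moreover have "x \<in> A i (v j)" using x by (auto simp: A_def)
        ultimately show False using avoid[OF i] less x(4) by simp
      qed
      then show "j = j'" if "j \<in> B3" "j' \<in> B3" for j j'
        using that by (meson linorder_neqE_nat)
    qed
    have fin: "finite (B1 \<union> B2 \<union> B3)" using B1 B2 B3 by simp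
    have "card (B i) \<le> card (B1 \<union> B2 \<union> B3)" by (rule card_mono[OF fin sub])
    also have "\<dots> \<le> 3"
      using card_Un_le[of "B1 \<union> B2" B3] card_Un_le[of B1 B2] B1 B2 B3 by linarith
    finally show ?thesis using finite_subset[OF sub fin] by simp
  qed
  note B = this
  have fin: "finite (\<Union>i\<in>I. B i)" using few(1) B by simp
  have "card (\<Union>i\<in>I. B i) \<le> (\<Sum>i\<in>I. card (B i))" by (rule card_UN_le[OF few(1)])
  also have "\<dots> \<le> (\<Sum>i\<in>I. 3)" using B by (intro sum_mono) simp
  also have "\<dots> < m" using few(2) large(1) by simp
  finally have "card (\<Union>i\<in>I. B i) < m" .
  then have "\<not> {..<m} \<subseteq> (\<Union>i\<in>I. B i)" using card_mono[OF fin, of "{..<m}"] by (metis card_lessThan not_less)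
  then obtain j where j: "j < m" "\<forall>i\<in>I. j \<notin> B i" by auto
  then have "\<forall>i\<in>I. 3 \<le> rdist (R i) u (v j)" by (auto simp: B_def)
  then show ?thesis using l j unfolding u_def v_def by blast
qed

text \<open>Induction on the height \<open>k\<close> below \<open>w\<close>. The witness stays below
  \<open>w\<close> so that, one level up, distances to it split at the cut vertex.\<close>

lemma many_stretched:
  assumes served: "\<And>a b. a \<in> words K D m \<Longrightarrow> b \<in> words K D m \<Longrightarrow>
      \<exists>i\<in>I. rdist (R i) a b \<le> rdist (wedges K D m) a b + 2"
    and "w \<in> words K D m" "inner w" "length w + k = K"
  shows "\<exists>s\<in>words K D m. suffix w s \<and>
    k \<le> card {i \<in> I. rdist (wedges K D m) w s < rdist (R i) w s}"
  using assms(2-4)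
proof (induction k arbitrary: w)
  case 0
  then show ?case by auto
next
  case (Suc k)
  let ?E = "wedges K D m"
  define N where "N x s = {i \<in> I. rdist ?E x s < rdist (R i) x s}" for x s
  have finN: "finite (N x s)" for x s using few(1) by (simp add: N_def)
  have D: "0 < D" using large(2) by simp
  have below: "rdist ?E a b \<le> rdist (R i) a b"
    if "i \<in> I" "a \<in> words K D m" "b \<in> words K D m" for i a b
    by (rule rdist_antimono[OF sub[OF that(1)] conn[OF that]])
  have tri: "rdist ?E a b \<le> rdist ?E a z + rdist ?E z b"
    if "a \<in> words K D m" "z \<in> words K D m" "b \<in> words K D m" for a b z
    by (rule rdist_triangle[OF wedges_connected[OF D that(1,2)] wedges_connected[OF D that(2,3)]])
  have R_sym: "rdist (R i) a b = rdist (R i) b a" if "i \<in> I" for i a b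
    by (rule rdist_sym[OF tree_sym[OF that]])
  have cut: "rdist (R i) a b = rdist (R i) a z + rdist (R i) z b"
    if "i \<in> I" "a \<in> words K D m" "z \<in> words K D m" "b \<in> words K D m"
      "suffix z b" "\<not> suffix z a" for i a b z
  proof -
    \<comment> \<open>Reversed, because the cut lemma starts inside the subtree below
      \<open>z\<close>.\<close>
    have "rdist (R i) b a = rdist (R i) b z + rdist (R i) z a"
    proof (rule rdist_through_cut[where S = "{x. suffix z x}"])
      show "y \<in> {x. suffix z x}" if "(x, y) \<in> R i" "x \<in> {x. suffix z x}" "x \<noteq> z" for x y
        using wedges_leave_subtree[of x y K D m z] that sub[OF \<open>i \<in> I\<close>] by blast
    qed (use that conn[OF that(1)] in simp_all)
    then show ?thesis using R_sym[OF that(1)] by simp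
  qed
  obtain l j where l: "length l = m" "set l \<subseteq> {..<D}" "j < m"
    and far: "\<And>i. i \<in> I \<Longrightarrow> 3 \<le> rdist (R i) (U l # w) (V (take j l) # w)"
    using branch_far_apart[of w] Suc.prems by auto
  define u where "u = U l # w"
  define v where "v = V (take j l) # w"
  have u: "u \<in> words K D m" and v: "v \<in> words K D m"
    using Suc.prems l set_take_subset[of j l] by (auto simp: u_def v_def Cons_in_words_iff)
  have uv: "(u, v) \<in> ?E" using u v by (auto simp: wedges_def wadj_def u_def v_def take_is_prefix)
  have two: "(w, u) \<in> ?E ^^ 2" "(w, v) \<in> ?E ^^ 2"
    using wedges_two_steps[OF D] u v by (auto simp: u_def v_def)
  \<comment> \<open>The root sees only the \<open>Y\<close> letters of its gadget, so no tree
    reaches \<open>u\<close> or \<open>v\<close> in fewer than two steps.\<close>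
  have eq2: "rdist (R i) w z = 2" if "i \<in> I" "z \<in> {u, v}" "rdist (R i) w z \<le> 2" for i z
  proof -
    have "z \<in> words K D m" using that u v by auto
    then have walk: "(w, z) \<in> R i ^^ rdist (R i) w z"
      by (rule relpow_rdist[OF conn[OF that(1) Suc.prems(1)]])
    have "w \<noteq> z" "(w, z) \<notin> ?E"
      using that(2) by (auto simp: wedges_def wadj_def u_def v_def)
    then have "rdist (R i) w z \<noteq> 0" "rdist (R i) w z \<noteq> 1"
      using walk sub[OF that(1)] by (metis relpow_0_E, metis relpow_1 subsetD)
    then show ?thesis using that(3) by linarith
  qed
  obtain su where su: "su \<in> words K D m" "suffix u su" "k \<le> card (N u su)"
    using Suc.IH[of u] u Suc.prems by (auto simp: N_def u_def inner_def)
  obtain sv where sv: "sv \<in> words K D m" "suffix v sv" "k \<le> card (N v sv)"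
    using Suc.IH[of v] v Suc.prems by (auto simp: N_def v_def inner_def)
  \<comment> \<open>A stretch from \<open>z\<close> to \<open>s\<close> persists from
    \<open>w\<close> to \<open>s\<close>, as the tree path passes through \<open>z\<close>; the
    cardinalities then force equality.\<close>
  have N_eq: "N w s = N z s"
    if "card (N w s) \<le> k" "k \<le> card (N z s)" "z \<in> {u, v}" "suffix z s" "s \<in> words K D m" for z s
  proof -
    have z: "z \<in> words K D m" "\<not> suffix z w"
      using that(3) u v by (auto simp: u_def v_def dest: suffix_length_le)
    have "N z s \<subseteq> N w s"
    proof
      fix i assume "i \<in> N z s"
      then have i: "i \<in> I" "rdist ?E z s < rdist (R i) z s" by (auto simp: N_def)
      have "rdist ?E w s \<le> rdist ?E w z + rdist ?E z s"
        using tri Suc.prems(1) z(1) that(5) by blast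
      also have "\<dots> < rdist (R i) w z + rdist (R i) z s"
        using below[OF i(1) Suc.prems(1) z(1)] i(2) by simp
      also have "\<dots> = rdist (R i) w s"
        using cut[OF i(1) Suc.prems(1) z(1) that(5,4) z(2)] by simp
      finally show "i \<in> N w s" using i(1) by (simp add: N_def)
    qed
    then show ?thesis using card_seteq[OF finN] that(1,2) by (metis order_trans)
  qed
  \<comment> \<open>A tree exact from \<open>w\<close> to \<open>s\<close> is exact on the part from
    \<open>w\<close> to \<open>z\<close>.\<close>
  have exact: "rdist (R i) w z = 2"
    if "i \<in> I" "i \<notin> N w s" "z \<in> {u, v}" "suffix z s" "s \<in> words K D m" for i z s
  proof -
    have z: "z \<in> words K D m" "\<not> suffix z w"
      using that(3) u v by (auto simp: u_def v_def dest: suffix_length_le)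
    have "rdist (R i) w z + rdist (R i) z s = rdist (R i) w s"
      using cut[OF that(1) Suc.prems(1) z(1) that(5,4) z(2)] by simp
    also have "\<dots> \<le> rdist ?E w s" using that(1,2) by (auto simp: N_def)
    also have "\<dots> \<le> rdist ?E w z + rdist ?E z s"
      using tri Suc.prems(1) z(1) that(5) by blast
    also have "\<dots> \<le> 2 + rdist (R i) z s"
    proof (rule add_mono)
      show "rdist ?E w z \<le> 2" using two that(3) by (auto intro: rdist_le)
    qed (rule below[OF that(1) z(1) that(5)])
    finally show ?thesis using eq2 that by simp
  qed
  show ?case
  proof (rule ccontr)
    assume neg: "\<not> ?thesis"
    have "suffix w u" "suffix w v" by (simp_all add: u_def v_def suffix_Cons)
    then have "suffix w su" "suffix w sv"
      using su(2) sv(2) by (auto intro: suffix_order.trans)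
    then have "card (N w su) \<le> k" "card (N w sv) \<le> k"
      using neg su(1) sv(1) by (auto simp: N_def not_less_eq_eq)
    then have N: "N w su = N u su" "N w sv = N v sv"
      using N_eq su sv by auto
    obtain i where i: "i \<in> I" "rdist (R i) su sv \<le> rdist ?E su sv + 2"
      using served[OF su(1) sv(1)] by blast
    have "\<not> suffix (x # w) w" for x
      using suffix_length_le[of "x # w" w] by auto
    then have "\<not> suffix u v" "\<not> suffix v u"
      by (simp_all add: u_def v_def suffix_Cons)
    then have nsuf: "\<not> suffix u sv" "\<not> suffix v u"
      using suffix_same_cases[OF _ sv(2), of u] by blast+
    have "rdist (R i) su sv = rdist (R i) su u + rdist (R i) u sv"
      using cut[OF i(1) sv(1) u su(1,2) nsuf(1)] by (simp add: R_sym[OF i(1), of _ sv] R_sym[OF i(1), of su u])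
    also have "rdist (R i) u sv = rdist (R i) u v + rdist (R i) v sv"
      using cut[OF i(1) u v sv(1,2) nsuf(2)] .
    finally have T: "rdist (R i) su sv = rdist (R i) u su + rdist (R i) u v + rdist (R i) v sv"
      by (simp add: R_sym[OF i(1), of su u])
    have "rdist ?E su sv \<le> rdist ?E su u + (rdist ?E u v + rdist ?E v sv)"
      using tri[OF su(1) u sv(1)] tri[OF u v sv(1)] by linarith
    also have "\<dots> \<le> rdist ?E u su + 1 + rdist ?E v sv"
      using rdist_le[of u v 1 ?E] uv rdist_sym[OF sym_wedges, of K D m su u] by simp
    \<comment> \<open>The surplus is at most 2, and passing from \<open>u\<close> to
      \<open>v\<close> costs at least 3 against 1, so every estimate is tight.\<close>
    finally have "rdist (R i) u v = 3" "rdist (R i) u su = rdist ?E u su" "rdist (R i) v sv = rdist ?E v sv"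
      using T i(2) far[OF i(1)] below[OF i(1) u su(1)] below[OF i(1) v sv(1)]
      by (simp_all add: u_def v_def)
    moreover from this have "i \<notin> N w su" "i \<notin> N w sv" unfolding N by (simp_all add: N_def)
    then have "rdist (R i) w u = 2" "rdist (R i) w v = 2"
      using exact[OF i(1) _ _ su(2,1)] exact[OF i(1) _ _ sv(2,1)] by simp_all
    \<comment> \<open>The three distances are 3, 2 and 2, with odd sum.\<close>
    moreover have "even (rdist (R i) u v + rdist (R i) w u + rdist (R i) w v)"
      by (rule bridges_only_parity[OF tree[OF i(1)] conn[OF i(1) Suc.prems(1) u] relpow_rdist[OF conn[OF i(1) u v]]])
    ultimately show False by simp
  qed
qed

text \<open>At the root \<open>[]\<close> the full height \<open>K\<close> is available, so more
  than \<open>\<mu>\<close> trees would be stretched.\<close>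

lemma some_pair_unserved:
  assumes "\<mu> < K"
  shows "\<exists>a\<in>words K D m. \<exists>b\<in>words K D m. \<forall>i\<in>I.
    rdist (wedges K D m) a b + 2 < rdist (R i) a b"
proof (rule ccontr)
  assume "\<not> ?thesis"
  then have "\<exists>i\<in>I. rdist (R i) a b \<le> rdist (wedges K D m) a b + 2"
    if "a \<in> words K D m" "b \<in> words K D m" for a b
    using that by (meson not_less)
  from many_stretched[OF this Nil_in_words, of K] obtain s
    where "K \<le> card {i \<in> I. rdist (wedges K D m) [] s < rdist (R i) [] s}"
    by (auto simp: inner_def)
  also have "\<dots> \<le> card I" using few(1) by (intro card_mono) auto
  finally show False using assms few(2) by simp
qed

end

section \<open>Pair digraphs\<close>

lemma pair_graph_iff:
  "pair_graph G \<longleftrightarrow> finite (pverts G) \<and> parcs G \<subseteq> pverts G \<times> pverts G \<and> sym (parcs G) \<and> irrefl (parcs G)"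
proof
  assume "pair_graph G"
  then interpret pair_graph G .
  show "finite (pverts G) \<and> parcs G \<subseteq> pverts G \<times> pverts G \<and> sym (parcs G) \<and> irrefl (parcs G)"
    using pair_finite_verts arc_fst_in_verts arc_snd_in_verts pair_no_loops pair_sym_arcs
    by (force simp: symmetric_def irrefl_def)
next
  assume G: "finite (pverts G) \<and> parcs G \<subseteq> pverts G \<times> pverts G \<and> sym (parcs G) \<and> irrefl (parcs G)"
  then have "finite (parcs G)" by (meson finite_SigmaI finite_subset)
  with G show "pair_graph G"
    by unfold_locales (auto simp: symmetric_def irrefl_def)
qed

lemma connected_iff_rtrancl:
  assumes "pair_graph G"
  shows "connected (with_proj G) \<longleftrightarrow>
    pverts G \<noteq> {} \<and> (\<forall>u\<in>pverts G. \<forall>v\<in>pverts G. (u, v) \<in> (parcs G)\<^sup>*)"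
proof -
  interpret pair_graph G by fact
  have "u \<rightarrow>\<^sup>*\<^bsub>mk_symmetric G\<^esub> v \<longleftrightarrow> (u, v) \<in> (parcs G)\<^sup>*" if "u \<in> pverts G" for u v
    using reachable_mk_symmetric_eq[OF pair_sym_arcs] reachable_conv'[OF that] by simp
  then show ?thesis
    by (simp add: connected_def strongly_connected_def mk_symmetric_def)
qed

lemma (in pair_wf_digraph) relpow_iff_awalk:
  assumes "u \<in> pverts G"
  shows "(u, v) \<in> parcs G ^^ n \<longleftrightarrow> (\<exists>p. awalk u p v \<and> length p = n)"
  using assms
proof (induction n arbitrary: u)
  case 0
  then show ?case by (auto simp: awalk_Nil_iff)
next
  case (Suc n)
  have "(u, v) \<in> parcs G ^^ Suc n \<longleftrightarrow> (\<exists>w. (u, w) \<in> parcs G \<and> (w, v) \<in> parcs G ^^ n)"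
    by (meson relpow_Suc_D2 relpow_Suc_I2)
  also have "\<dots> \<longleftrightarrow> (\<exists>w p. (u, w) \<in> parcs G \<and> awalk w p v \<and> length p = n)"
    using Suc.IH in_arcsD2 by blast
  also have "\<dots> \<longleftrightarrow> (\<exists>p. awalk u p v \<and> length p = Suc n)"
  proof
    assume "\<exists>w p. (u, w) \<in> parcs G \<and> awalk w p v \<and> length p = n"
    then obtain w p where "(u, w) \<in> parcs G" "awalk w p v" "length p = n" by blast
    then show "\<exists>p. awalk u p v \<and> length p = Suc n"
      by (intro exI[of _ "(u, w) # p"]) (simp add: awalk_Cons_iff)
  next
    assume "\<exists>p. awalk u p v \<and> length p = Suc n"
    then obtain e p where "awalk u (e # p) v" "length p = n" by (auto simp: length_Suc_conv)
    then show "\<exists>w p. (u, w) \<in> parcs G \<and> awalk w p v \<and> length p = n"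
      by (intro exI[of _ "snd e"] exI[of _ p]) (auto simp: awalk_Cons_iff)
  qed
  finally show ?case .
qed

lemma gdist_eq_rdist:
  assumes "pair_graph G" "u \<in> pverts G" "(u, v) \<in> (parcs G)\<^sup>*"
  shows "gdist G u v = ereal (real (rdist (parcs G) u v))"
proof -
  interpret pair_graph G by fact
  have cost: "awalk_cost (\<lambda>_. 1) p = real (length p)" for p :: "('a \<times> 'a) list"
    by (induction p) auto
  show ?thesis
    unfolding gdist_def
  proof (rule antisym)
    obtain p where p: "awalk u p v" "length p = rdist (parcs G) u v"
      using relpow_rdist[OF assms(3)] relpow_iff_awalk[OF assms(2)] by blast
    show "\<mu> (\<lambda>_. 1) u v \<le> ereal (real (rdist (parcs G) u v))"
      using min_cost_le_walk_cost[OF p(1), of "\<lambda>_. 1"] p(2) by (simp add: cost)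
    show "ereal (real (rdist (parcs G) u v)) \<le> \<mu> (\<lambda>_. 1) u v"
      unfolding \<mu>_def
    proof (rule INF_greatest)
      fix p assume "p \<in> {p. awalk u p v}"
      then have "(u, v) \<in> parcs G ^^ length p" using relpow_iff_awalk[OF assms(2)] by blast
      then show "ereal (real (rdist (parcs G) u v)) \<le> ereal (awalk_cost (\<lambda>_. 1) p)"
        by (simp add: cost rdist_le)
    qed
  qed
qed

lemma pawalk_verts_snoc: "pcas u p v \<Longrightarrow> pawalk_verts u (p @ [(v, z)]) = pawalk_verts u p @ [z]"
  by (induction u p v rule: pcas.induct) auto

text \<open>A walk around the edge contains a path of at least two arcs, which \<open>(y, x)\<close>
  closes to a cycle of length at least three.\<close>

lemma acyclic_bridges_only:
  assumes "pair_graph T" "\<nexists>p. ucycle T p"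
  shows "bridges_only (parcs T)"
  unfolding bridges_only_def
proof (intro conjI allI impI notI)
  show "sym (parcs T)" using assms(1) by (simp add: pair_graph_iff)
  interpret T: pair_graph T by fact
  fix x y assume xy: "(x, y) \<in> parcs T" and path: "(x, y) \<in> (parcs T - {(x, y), (y, x)})\<^sup>*"
  define H where "H = \<lparr>pverts = pverts T, parcs = parcs T - {(x, y), (y, x)}\<rparr>"
  interpret H: pair_wf_digraph H
    using T.arc_fst_in_verts T.arc_snd_in_verts by unfold_locales (auto simp: H_def)
  have V: "x \<in> pverts T" "y \<in> pverts T" "x \<noteq> y" "(y, x) \<in> parcs T"
    using assms(1) xy by (auto simp: pair_graph_iff irrefl_def dest: symD)
  have "x \<rightarrow>\<^sup>*\<^bsub>H\<^esub> y"
    using H.reachable_conv'[of x y] path V by (simp add: H_def)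
  then obtain p where p: "H.apath x p y" using H.reachable_apath by blast
  then have "pcas x p y \<and> set p \<subseteq> parcs H \<and> distinct (pawalk_verts x p)"
    by (simp add: H.apath_def H.awalk_def)
  then have w: "pcas x p y" "set p \<subseteq> parcs T - {(x, y), (y, x)}" "distinct (pawalk_verts x p)"
    by (simp_all add: H_def)
  have "p \<noteq> []" using w V by auto
  moreover have "length p \<noteq> 1"
    using w by (auto simp: length_Suc_conv)
  ultimately have "2 \<le> length p" by (cases p rule: remdups_adj.cases) auto
  moreover have "pre_digraph.cycle (with_proj T) (p @ [(y, x)])"
  proof -
    have "T.awalk x p y" using w V by (auto simp: T.awalk_def)
    then have walk: "T.awalk x (p @ [(y, x)]) x"
      using V by (auto simp: T.awalk_append_iff T.awalk_Cons_iff T.awalk_Nil_iff)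
    have "pawalk_verts x (p @ [(y, x)]) = pawalk_verts x p @ [x]"
      using w(1) by (rule pawalk_verts_snoc)
    moreover obtain vs where "pawalk_verts x p = x # vs"
      using w(1) by (cases p) auto
    ultimately have "distinct (tl (pawalk_verts x (p @ [(y, x)])))" using w(3) by simp
    with walk show ?thesis unfolding T.cycle_def by blast
  qed
  ultimately have "ucycle T (p @ [(y, x)])" by (simp add: ucycle_def)
  with assms(2) show False by blast
qed

section \<open>Vertex sequences of cycles\<close>

lemma pcas_map_fst_snd: "pcas u p v \<Longrightarrow> map fst p @ [v] = u # map snd p"
  by (induction u p v rule: pcas.induct) auto

lemma pawalk_verts_map: "pcas u p v \<Longrightarrow> pawalk_verts u p = u # map snd p"
  by (induction u p v rule: pcas.induct) auto

lemma ucycle_nth: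
  assumes "pair_graph G" "ucycle G p"
  obtains x where "inj_on x {..<length p}"
    "\<And>i. i < length p \<Longrightarrow> p ! i = (x i, x (Suc i mod length p))"
    "\<And>i. i < length p \<Longrightarrow> (x i, x (Suc i mod length p)) \<in> parcs G"
proof
  interpret pair_graph G by fact
  obtain u where u: "pcas u p u" "set p \<subseteq> parcs G" "distinct (tl (pawalk_verts u p))" "p \<noteq> []"
    using assms(2) by (auto simp: ucycle_def cycle_def awalk_def)
  define x where "x i = fst (p ! i)" for i
  have eq: "map fst p @ [u] = u # map snd p" using pcas_map_fst_snd[OF u(1)] .
  \<comment> \<open>Distinctness is known for the second components of the arcs; as the walk is
    closed, the first components form the same multiset.\<close>
  have "mset (map fst p) = mset (map snd p)"
    using arg_cong[OF eq, of mset] by simp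
  then have "distinct (map fst p)"
    using u(1,3) by (metis pawalk_verts_map list.sel(3) mset_eq_imp_distinct_iff)
  then show "inj_on (\<lambda>i. fst (p ! i)) {..<length p}"
    by (auto simp: inj_on_def distinct_conv_nth)
  have snd: "snd (p ! i) = fst (p ! (Suc i mod length p))" if "i < length p" for i
  proof -
    have "snd (p ! i) = (map fst p @ [u]) ! Suc i" using that by (simp add: eq)
    also have "\<dots> = fst (p ! (Suc i mod length p))"
    proof (cases "Suc i = length p")
      case True
      have "fst (p ! 0) = (map fst p @ [u]) ! 0" using u(4) by (simp add: nth_append)
      also have "\<dots> = u" by (simp add: eq)
      finally show ?thesis using True by (simp add: nth_append)
    qed (use that in \<open>simp add: nth_append\<close>)
    finally show ?thesis .
  qed
  then show "p ! i = (fst (p ! i), fst (p ! (Suc i mod length p)))" if "i < length p" for i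
    using that by (simp add: prod_eq_iff)
  then show "(fst (p ! i), fst (p ! (Suc i mod length p))) \<in> parcs G" if "i < length p" for i
    using that u(2) by (metis nth_mem subsetD)
qed

section \<open>Strong chordality from an elimination ranking\<close>

lemma cycle_dist_eq_3:
  assumes "6 \<le> n" "i = j + 3 \<or> j = i + 3 \<or> i + n = j + 3 \<or> j + n = i + 3"
  shows "cycle_dist n i j = 3"
  using assms(2)
proof (elim disjE)
  assume "i + n = j + 3"
  then have "i \<le> j" "j - i = n - 3" "min (n - 3) (n - (n - 3)) = 3" using assms(1) by auto
  then show ?thesis by (simp add: cycle_dist_def)
next
  assume "j + n = i + 3"
  then have "j \<le> i" "i - j = n - 3" "min (n - 3) (n - (n - 3)) = 3" using assms(1) by auto
  then show ?thesis by (simp add: cycle_dist_def)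
qed (use assms(1) in \<open>simp_all add: cycle_dist_def\<close>)

text \<open>
  On a cycle, apply the elimination property at a vertex of least rank: its two neighbours are
  adjacent, and one of them is adjacent to the vertex two steps away on the other side.
\<close>

lemma strongly_chordalI:
  fixes rank :: "'a \<Rightarrow> nat"
  assumes G: "simple_connected_graph G"
    and elim: "\<And>a b p q. {a, b, p, q} \<subseteq> pverts G \<Longrightarrow> rank a \<le> rank b \<Longrightarrow> rank p \<le> rank q \<Longrightarrow>
      a = p \<or> (a, p) \<in> parcs G \<Longrightarrow> a = q \<or> (a, q) \<in> parcs G \<Longrightarrow> b = p \<or> (b, p) \<in> parcs G \<Longrightarrow>
      b = q \<or> (b, q) \<in> parcs G"
  shows "strongly_chordal G"
proof -
  have pg: "pair_graph G" using G by (simp add: simple_connected_graph_def)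
  then have arcs: "parcs G \<subseteq> pverts G \<times> pverts G" and sym: "sym (parcs G)"
    by (simp_all add: pair_graph_iff)
  have min_vertex: "\<exists>x i. inj_on x {..<length p} \<and> i < length p \<and>
      (\<forall>j<length p. p ! j = (x j, x (Suc j mod length p)) \<and> (x j, x (Suc j mod length p)) \<in> parcs G \<and>
        rank (x i) \<le> rank (x j))" if cyc: "ucycle G p" for p
  proof -
    obtain x where "inj_on x {..<length p}"
      "\<And>i. i < length p \<Longrightarrow> p ! i = (x i, x (Suc i mod length p))"
      "\<And>i. i < length p \<Longrightarrow> (x i, x (Suc i mod length p)) \<in> parcs G"
      using ucycle_nth[OF pg cyc] by metis
    moreover have "length p \<noteq> 0" using cyc by (auto simp: ucycle_def)
    then obtain i where "i < length p" "\<forall>j<length p. rank (x i) \<le> rank (x j)"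
      using arg_min_if_finite[of "{..<length p}" "\<lambda>j. rank (x j)"]
      by (metis finite_lessThan lessThan_empty_iff lessThan_iff not_less)
    ultimately show ?thesis by blast
  qed
  have "\<not> (induced_cycle G p \<and> 3 < length p)" for p
  proof
    assume p: "induced_cycle G p \<and> 3 < length p"
    define n where "n = length p"
    obtain x i where x: "inj_on x {..<n}" "i < n"
      "\<And>j. j < n \<Longrightarrow> p ! j = (x j, x (Suc j mod n)) \<and> (x j, x (Suc j mod n)) \<in> parcs G \<and>
        rank (x i) \<le> rank (x j)"
      using min_vertex[of p] p unfolding n_def induced_cycle_def by blast
    have n: "3 < n" using p by (simp add: n_def)
    define s r where "s = (if Suc i = n then 0 else Suc i)" and "r = (if i = 0 then n - 1 else i - 1)"
    have sr: "s < n" "r < n" "Suc i mod n = s" "Suc r mod n = i" "s \<noteq> r" "Suc s mod n \<noteq> r" "Suc r mod n \<noteq> s"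
      using n x(2) by (auto simp: s_def r_def mod_Suc)
    have edge: "(x i, x s) \<in> parcs G" "(x i, x r) \<in> parcs G"
      using x(3)[of i] x(3)[of r] sr x(2) sym by (auto dest: symD)
    then have V: "x i \<in> pverts G" "x s \<in> pverts G" "x r \<in> pverts G" using arcs by auto
    have le: "rank (x i) \<le> rank (x s)" "rank (x i) \<le> rank (x r)" using x(3) sr by simp_all
    \<comment> \<open>The neighbour of smaller rank serves as both \<open>b\<close> and
      \<open>p\<close> in \<open>elim\<close>, through the equality alternative.\<close>
    have "(x s, x r) \<in> parcs G \<or> x s = x r"
    proof (cases "rank (x s) \<le> rank (x r)")
      case True
      then show ?thesis using elim[of "x i" "x s" "x s" "x r"] V le edge by auto
    next
      case False
      then have "x r = x s \<or> (x r, x s) \<in> parcs G"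
        using elim[of "x i" "x r" "x r" "x s"] V le edge by simp
      then show ?thesis by (metis sym symD)
    qed
    moreover have "x s \<noteq> x r" using inj_on_eq_iff[OF x(1)] sr by simp
    ultimately have "(x s, x r) \<in> parcs G" by simp
    moreover have "x k \<in> set (map fst p)" if "k < n" for k
      using imageI[OF nth_mem[of k p], of fst] x(3)[OF that] that by (simp add: n_def)
    ultimately have "(x s, x r) \<in> arcs (with_proj G \<restriction> set (map fst p))" using sr by simp
    then have "(x s, x r) \<in> set p \<union> (set p)\<inverse>"
      using p unfolding induced_cycle_def by blast
    then consider k where "k < n" "p ! k = (x s, x r)" | k where "k < n" "p ! k = (x r, x s)"
      by (auto simp: in_set_conv_nth n_def)
    then show False
    proof cases
      case 1
      then have "x s = x k" "x r = x (Suc k mod n)" using x(3)[of k] by auto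
      then have "s = k" "r = Suc k mod n"
        using 1 sr n inj_on_eq_iff[OF x(1)] by simp_all
      then show False using sr by simp
    next
      case 2
      then have "x r = x k" "x s = x (Suc k mod n)" using x(3)[of k] by auto
      then have "r = k" "s = Suc k mod n"
        using 2 sr n inj_on_eq_iff[OF x(1)] by simp_all
      then show False using sr by simp
    qed
  qed
  moreover have "has_odd_chord G p" if p: "ucycle G p \<and> even (length p) \<and> 6 \<le> length p" for p
  proof -
    define n where "n = length p"
    obtain x i where x: "inj_on x {..<n}" "i < n"
      "\<And>j. j < n \<Longrightarrow> p ! j = (x j, x (Suc j mod n)) \<and> (x j, x (Suc j mod n)) \<in> parcs G \<and>
        rank (x i) \<le> rank (x j)"
      using min_vertex[of p] p unfolding n_def by blast
    have n: "6 \<le> n" using p by (simp add: n_def)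
    \<comment> \<open>Positions counted from \<open>i\<close> around the cycle, so that
      \<open>s n\<close> is again \<open>i\<close>.\<close>
    define s where "s k = (if i + k < n then i + k else i + k - n)" for k
    have s: "s k < n" "Suc (s k) mod n = s (Suc k)" if "k < n" for k
      using that x(2) by (auto simp: s_def mod_Suc)
    have s0: "s 0 = i" "s n = i" using x(2) by (auto simp: s_def)
    have edge: "(x (s k), x (s (Suc k))) \<in> parcs G" "(x (s (Suc k)), x (s k)) \<in> parcs G" if "k < n" for k
      using x(3)[of "s k"] s[OF that] sym by (auto dest: symD)
    have V: "x (s k) \<in> pverts G" if "k < n" for k
      using edge[OF that] arcs by auto
    \<comment> \<open>In \<open>elim\<close>, \<open>p\<close> is the neighbour of
      \<open>x i\<close> of smaller rank, \<open>q\<close> the other one and \<open>b\<close> the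
      vertex beyond \<open>p\<close>; \<open>b\<close> and \<open>q\<close> are three steps
      apart.\<close>
    have chord: "\<exists>j j'. j < n \<and> j' < n \<and> (x j, x j') \<in> parcs G \<and> cycle_dist n j j' = 3"
    proof (cases "rank (x (s 1)) \<le> rank (x (s (n - 1)))")
      case True
      have "(x (s 0), x (s 1)) \<in> parcs G" "(x (s 2), x (s 1)) \<in> parcs G"
        "(x (s 0), x (s (n - 1))) \<in> parcs G"
        using edge[of 0] edge[of 1] edge[of "n - 1"] n s0 by (simp_all add: numeral_2_eq_2)
      moreover have "rank (x (s 0)) \<le> rank (x (s 2))" using x(3) s(1)[of 2] s0 n by simp
      ultimately have "x (s 2) = x (s (n - 1)) \<or> (x (s 2), x (s (n - 1))) \<in> parcs G"
        using elim[of "x (s 0)" "x (s 2)" "x (s 1)" "x (s (n - 1))"] True V n by simp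
      moreover have "s 2 \<noteq> s (n - 1)" using n x(2) by (auto simp: s_def)
      then have "x (s 2) \<noteq> x (s (n - 1))" using inj_on_eq_iff[OF x(1)] s(1) n by simp
      moreover have "s 2 + n = s (n - 1) + 3 \<or> s (n - 1) = s 2 + 3 \<or> s 2 = s (n - 1) + 3"
        using n x(2) by (auto simp: s_def)
      then have "cycle_dist n (s 2) (s (n - 1)) = 3"
        using cycle_dist_eq_3[OF n] by blast
      ultimately show ?thesis using s(1)[of 2] s(1)[of "n - 1"] n by force
    next
      case False
      have "Suc (n - 2) = n - 1" "Suc (n - 1) = n" using n by simp_all
      then have "(x (s (n - 2)), x (s (n - 1))) \<in> parcs G" "(x (s 0), x (s (n - 1))) \<in> parcs G"
        "(x (s 0), x (s 1)) \<in> parcs G"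
        using edge(1)[of "n - 2"] edge(2)[of "n - 1"] edge(1)[of 0] n s0 by simp_all
      moreover have "rank (x (s 0)) \<le> rank (x (s (n - 2)))" using x(3) s(1)[of "n - 2"] s0 n by simp
      ultimately have "x (s (n - 2)) = x (s 1) \<or> (x (s (n - 2)), x (s 1)) \<in> parcs G"
        using elim[of "x (s 0)" "x (s (n - 2))" "x (s (n - 1))" "x (s 1)"] False V n by simp
      moreover have "s (n - 2) \<noteq> s 1" using n x(2) by (auto simp: s_def)
      then have "x (s (n - 2)) \<noteq> x (s 1)" using inj_on_eq_iff[OF x(1)] s(1) n by simp
      moreover have "s 1 + n = s (n - 2) + 3 \<or> s (n - 2) = s 1 + 3 \<or> s 1 = s (n - 2) + 3"
        using n x(2) by (auto simp: s_def)
      then have "cycle_dist n (s (n - 2)) (s 1) = 3"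
        using cycle_dist_eq_3[OF n] by blast
      ultimately show ?thesis using s(1)[of 1] s(1)[of "n - 2"] n by force
    qed
    then obtain j j' where j: "j < n" "j' < n" "(x j, x j') \<in> parcs G" "cycle_dist n j j' = 3" by blast
    then have "(fst (p ! j), fst (p ! j')) \<in> parcs G" using x(3)[of j] x(3)[of j'] by simp
    with j show ?thesis unfolding has_odd_chord_def n_def by fastforce
  qed
  ultimately show ?thesis using G unfolding strongly_chordal_def chordal_def by blast
qed

section \<open>Passage to natural numbers as vertices\<close>

theorem theorem11:
  fixes \<mu> :: nat
  assumes "\<mu> \<ge> 1"
  shows "\<exists>G :: nat pair_pre_digraph. strongly_chordal G \<and>
           \<not> (\<exists>\<T>. finite \<T> \<and> card \<T> \<le> \<mu> \<and> collectively_spans 2 \<T> G)"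
proof -
  \<comment> \<open>Height \<open>\<mu> + 1\<close> exceeds the number of trees; \<open>D\<close>
    and \<open>m\<close> are the least values that \<open>tree_family\<close> allows.\<close>
  define K D m where "K = Suc \<mu>" and "D = Suc (2 * \<mu>)" and "m = Suc (3 * \<mu>)"
  let ?W = "words K D m" and ?E = "wedges K D m"
  define f :: "letter list \<Rightarrow> nat" where "f = to_nat"
  define G where "G = \<lparr>pverts = f ` ?W, parcs = map_prod f f ` ?E\<rparr>"
  define g :: "nat \<Rightarrow> letter list" where "g = from_nat"
  have g_f: "g (f a) = a" for a by (simp add: f_def g_def)
  have f_eq: "f a = f b \<longleftrightarrow> a = b" for a b by (simp add: f_def)
  have arc_iff: "(f a, f b) \<in> parcs G \<longleftrightarrow> (a, b) \<in> ?E" for a b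
    by (auto simp: G_def f_eq)
  have E_sub: "?E \<subseteq> ?W \<times> ?W" by (auto simp: wedges_def)
  have path_f: "(f a, f b) \<in> (map_prod f f ` S)\<^sup>*" if "(a, b) \<in> S\<^sup>*" for a b S
    using that by (induction rule: rtrancl_induct) (auto intro: rtrancl_into_rtrancl)
  have pg: "pair_graph G"
    unfolding pair_graph_iff
  proof (intro conjI)
    show "sym (parcs G)" using sym_wedges[of K D m] by (auto simp: G_def sym_def)
    show "irrefl (parcs G)" using wadj_irrefl by (auto simp: G_def irrefl_def wedges_def f_eq)
  qed (use finite_words E_sub in \<open>auto simp: G_def\<close>)
  have sc: "simple_connected_graph G"
    unfolding simple_connected_graph_def connected_iff_rtrancl[OF pg]
    using pg path_f wedges_connected[of D _ K m] Nil_in_words[of K D m] by (auto simp: G_def D_def)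
  have "strongly_chordal G"
  proof (rule strongly_chordalI[OF sc, where rank = "\<lambda>x. wrank K m (g x)"])
    fix a b p q
    assume V: "{a, b, p, q} \<subseteq> pverts G"
      and h: "wrank K m (g a) \<le> wrank K m (g b)"
        "wrank K m (g p) \<le> wrank K m (g q)"
        "a = p \<or> (a, p) \<in> parcs G" "a = q \<or> (a, q) \<in> parcs G" "b = p \<or> (b, p) \<in> parcs G"
    from V obtain a' b' p' q' where W: "{a', b', p', q'} \<subseteq> ?W"
      and eq: "a = f a'" "b = f b'" "p = f p'" "q = f q'"
      by (auto simp: G_def)
    have "wrank K m a' \<le> wrank K m b'" "wrank K m p' \<le> wrank K m q'"
      "a' = p' \<or> wadj a' p'" "a' = q' \<or> wadj a' q'" "b' = p' \<or> wadj b' p'"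
      using h by (auto simp: eq arc_iff f_eq g_f wedges_def)
    then have "b' = q' \<or> wadj b' q'" by (rule word_strong_elimination[OF W])
    then show "b = q \<or> (b, q) \<in> parcs G" using W by (auto simp: eq arc_iff wedges_def)
  qed
  moreover have "\<not> collectively_spans 2 \<T> G" if \<T>: "finite \<T>" "card \<T> \<le> \<mu>" for \<T>
  proof
    assume span: "collectively_spans 2 \<T> G"
    \<comment> \<open>Trees are pulled back along the injection \<open>f\<close>; no edge is lost,
      since the arcs of \<open>T\<close> are arcs of \<open>G\<close>.\<close>
    define R where "R (T :: nat pair_pre_digraph) = {(a, b). (f a, f b) \<in> parcs T}" for T
    have T: "pair_graph T" "pverts T = pverts G" "parcs T \<subseteq> parcs G" "bridges_only (parcs T)"
      "\<And>u v. u \<in> pverts G \<Longrightarrow> v \<in> pverts G \<Longrightarrow> (u, v) \<in> (parcs T)\<^sup>*" if "T \<in> \<T>" for T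
    proof -
      have *: "simple_connected_graph T" "\<nexists>p. ucycle T p" "spanning (with_proj T) (with_proj G)"
        using span that by (auto simp: collectively_spans_def uspanning_tree_def)
      then show pT: "pair_graph T" by (simp add: simple_connected_graph_def)
      show VT: "pverts T = pverts G" and "parcs T \<subseteq> parcs G"
        using *(3) by (auto simp: spanning_def subgraph_def)
      show "bridges_only (parcs T)" using acyclic_bridges_only[OF pT *(2)] .
      show "(u, v) \<in> (parcs T)\<^sup>*" if "u \<in> pverts G" "v \<in> pverts G" for u v
        using *(1) that connected_iff_rtrancl[OF pT] VT by (simp add: simple_connected_graph_def)
    qed
    have parcs_R: "parcs T = map_prod f f ` R T" if "T \<in> \<T>" for T
      using T(3)[OF that] by (auto simp: R_def G_def image_iff)
    have relpow_f: "(f a, f b) \<in> (map_prod f f ` S) ^^ n \<longleftrightarrow> (a, b) \<in> S ^^ n" for a b n S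
    proof (induction n arbitrary: b)
      case (Suc n)
      show ?case
      proof
        assume "(f a, f b) \<in> (map_prod f f ` S) ^^ Suc n"
        then obtain c where "(f a, f c) \<in> (map_prod f f ` S) ^^ n" "(c, b) \<in> S"
          by (auto simp: f_eq)
        then show "(a, b) \<in> S ^^ Suc n" using Suc by auto
      next
        assume "(a, b) \<in> S ^^ Suc n"
        then show "(f a, f b) \<in> (map_prod f f ` S) ^^ Suc n" using Suc by auto
      qed
    qed (auto simp: f_eq)
    have rtrancl_f: "(f a, f b) \<in> (map_prod f f ` S)\<^sup>* \<longleftrightarrow> (a, b) \<in> S\<^sup>*" for a b S
      by (simp add: rtrancl_power relpow_f)
    have rdist_f: "rdist (map_prod f f ` S) (f a) (f b) = rdist S a b" for a b S
      by (simp add: rdist_def relpow_f)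
    have bridges: "bridges_only (R T)" if "T \<in> \<T>" for T
      unfolding bridges_only_def
    proof (intro conjI allI impI notI)
      show "sym (R T)" using T(1)[OF that] by (auto simp: pair_graph_iff R_def sym_def)
      fix x y assume xy: "(x, y) \<in> R T" "(x, y) \<in> (R T - {(x, y), (y, x)})\<^sup>*"
      have "map_prod f f ` (R T - {(x, y), (y, x)}) = parcs T - {(f x, f y), (f y, f x)}"
        unfolding parcs_R[OF that] by (auto simp: f_eq)
      then have "(f x, f y) \<in> (parcs T - {(f x, f y), (f y, f x)})\<^sup>*"
        using xy(2) rtrancl_f by metis
      then show False using T(4)[OF that] xy(1) by (auto simp: bridges_only_def R_def)
    qed
    interpret tree_family K D m \<mu> \<T> R
    proof
      show "R T \<subseteq> ?E" if "T \<in> \<T>" for T using T(3)[OF that] arc_iff by (auto simp: R_def)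
      show "(a, b) \<in> (R T)\<^sup>*" if "T \<in> \<T>" "a \<in> ?W" "b \<in> ?W" for T a b
        using T(5)[OF that(1), of "f a" "f b"] that parcs_R[OF that(1)] rtrancl_f by (simp add: G_def)
    qed (use \<T> bridges in \<open>auto simp: D_def m_def\<close>)
    obtain a b where ab: "a \<in> ?W" "b \<in> ?W"
      "\<forall>T\<in>\<T>. rdist ?E a b + 2 < rdist (R T) a b"
      using some_pair_unserved by (auto simp: K_def)
    have V: "f a \<in> pverts G" "f b \<in> pverts G" using ab by (auto simp: G_def)
    obtain T where T': "T \<in> \<T>" "gdist T (f a) (f b) \<le> gdist G (f a) (f b) + ereal 2"
      using span V unfolding collectively_spans_def by blast
    have "gdist T (f a) (f b) = ereal (real (rdist (R T) a b))"
      using gdist_eq_rdist[OF T(1)[OF T'(1)] _ T(5)[OF T'(1) V]] V T(2)[OF T'(1)] parcs_R[OF T'(1)] rdist_f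
      by simp
    moreover have "gdist G (f a) (f b) = ereal (real (rdist ?E a b))"
      using gdist_eq_rdist[OF pg V(1)] path_f wedges_connected[of D a K m b] ab rdist_f
      by (simp add: G_def D_def)
    ultimately have "rdist (R T) a b \<le> rdist ?E a b + 2" using T'(2) by simp
    then show False using ab(3) T'(1) by fastforce
  qed
  ultimately show ?thesis by blast
qed

end
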